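(* Let $\Omega\subsetneq\mathbb{C}$ be a domain satisfying $\Omega+1\subseteq\Omega$. For any $z\in\Omega$, we have that $$\liminf_{n\to+\infty} \frac{d_\Omega(z,z+n)}{\log n}\geq \frac{1}{4}.$$
   Context: A domain $D\subseteq\mathbb{C}$ is hyperbolic if $\mathbb{C}\setminus D$ contains at least two points (this holds for the domains $\Omega$ in the claim). Its hyperbolic metric $\lambda_D(z)|dz|$ is determined by $\lambda_D(\pi(z))|\pi'(z)|=\frac{1}{1-|z|^2}$, $z\in\mathbb{D}$, for any holomorphic universal covering $\pi\colon\mathbb{D}\to D$ of $D$ by the unit disc $\mathbb{D}$. The hyperbolic distance is $d_D(z,w)=\inf_\gamma\int_\gamma\lambda_D(\zeta)|d\zeta|$, the infimum being over all piecewise $C^1$ curves in $D$ joining $z$ and $w$. *)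

theory Defs
  imports "HOL-Complex_Analysis.Complex_Analysis"
begin

text \<open>The unit disc is simply connected, so every covering of \<open>D\<close> by it is universal.\<close>

definition holomorphic_universal_covering :: "(complex \<Rightarrow> complex) \<Rightarrow> complex set \<Rightarrow> bool" where
  "holomorphic_universal_covering p D \<longleftrightarrow>
     p holomorphic_on ball 0 1 \<and> covering_space (ball 0 1) p D"

text \<open>
  All members of the family have the same value (lemma \<open>hyperbolic_density_covering\<close>),
  so the infimum merely selects the number determined by any one covering. If \<open>D\<close> has no covering by
  the disc, that is, if \<open>D\<close> is not a hyperbolic domain, then the infimum is \<open>\<infinity>\<close> by convention.
\<close>

definition hyperbolic_density :: "complex set \<Rightarrow> complex \<Rightarrow> ennreal" where
  "hyperbolic_density D w =
     (INF (p, z) \<in> {(p, z). holomorphic_universal_covering p D \<and> z \<in> ball 0 1 \<and> p z = w}.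
        ennreal (1 / ((1 - (norm z)\<^sup>2) * norm (deriv p z))))"

definition hyperbolic_dist :: "complex set \<Rightarrow> complex \<Rightarrow> complex \<Rightarrow> ennreal" where
  "hyperbolic_dist D z w =
     (INF \<gamma> \<in> {\<gamma>. valid_path \<gamma> \<and> path_image \<gamma> \<subseteq> D \<and> pathstart \<gamma> = z \<and> pathfinish \<gamma> = w}.
        \<integral>\<^sup>+ t \<in> {0..1}. hyperbolic_density D (\<gamma> t) * ennreal (norm (vector_derivative \<gamma> (at t))) \<partial>lborel)"

lemma Schwarz_Pick_deriv:
  assumes f: "f holomorphic_on ball 0 1" and fim: "f \<in> ball 0 1 \<rightarrow> ball 0 1" and z: "z \<in> ball 0 1"
  shows "norm (deriv f z) * (1 - (norm z)\<^sup>2) \<le> 1 - (norm (f z))\<^sup>2"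
proof -
  define a where "a = f z"
  have a: "norm a < 1" using fim z by (auto simp: a_def Pi_iff)
  have z': "norm z < 1" using z by simp
  define A where "A = Moebius_function 0 a"
  define B where "B = Moebius_function 0 (-z)"
  have B0: "B 0 = z" by (simp add: B_def Moebius_function_of_zero)
  have holA: "A holomorphic_on ball 0 1" and holB: "B holomorphic_on ball 0 1"
    using a z' by (simp_all add: A_def B_def Moebius_function_holomorphic)
  have Bim: "B u \<in> ball 0 1" if "norm u < 1" for u
    using Moebius_function_norm_lt_1[of "-z" u 0] z' that by (simp add: B_def)
  have Aim: "norm (A u) < 1" if "norm u < 1" for u
    using Moebius_function_norm_lt_1[of a u 0] a that by (simp add: A_def)
  define g where "g = (\<lambda>u. A (f (B u)))"
  have fB: "f (B u) \<in> ball 0 1" if "norm u < 1" for u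
    using Bim[OF that] fim by blast
  have holfB: "(\<lambda>u. f (B u)) holomorphic_on ball 0 1"
    using holomorphic_on_compose_gen[OF holB f] Bim by (force simp: o_def)
  have holg: "g holomorphic_on ball 0 1"
    unfolding g_def
    using holomorphic_on_compose_gen[OF holfB holA] fB by (force simp: o_def)
  have g0: "g 0 = 0"
    by (simp add: g_def B0 A_def a_def[symmetric] Moebius_function_eq_zero)
  have "norm (deriv g 0) \<le> 1"
    using Schwarz_Lemma(2)[OF holg g0, of 0] fB Aim by (auto simp: g_def)
  have na: "1 - cnj a * a = of_real (1 - (norm a)\<^sup>2)"
    by (simp only: of_real_diff complex_norm_square of_real_1) (simp add: mult.commute)
  have apos: "1 - (norm a)\<^sup>2 > 0" and zpos: "1 - (norm z)\<^sup>2 > 0"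
    using a z' by (simp_all add: power_less_one_iff abs_square_less_1)
  have ca: "1 - cnj a * a \<noteq> 0" unfolding na using apos by (simp only: of_real_eq_0_iff)
  have dA: "(A has_field_derivative 1 / of_real (1 - (norm a)\<^sup>2)) (at a)"
  proof -
    have "(A has_field_derivative ((1 * (1 - cnj a * a) - (a - a) * (- cnj a)) / ((1 - cnj a * a) * (1 - cnj a * a)))) (at a)"
      unfolding A_def Moebius_function_def using ca
      by (auto intro!: derivative_eq_intros)
    then show ?thesis using ca unfolding na[symmetric] by simp
  qed
  have dB: "(B has_field_derivative of_real (1 - (norm z)\<^sup>2)) (at 0)"
  proof -
    have "(B has_field_derivative (1 - z * cnj z)) (at 0)"
      unfolding B_def Moebius_function_def
      by (auto intro!: derivative_eq_intros)
    then show ?thesis by (simp only: of_real_diff complex_norm_square of_real_1)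
  qed
  have df: "(f has_field_derivative deriv f z) (at z)"
    using f z holomorphic_derivI by blast
  have "((\<lambda>u. f (B u)) has_field_derivative deriv f z * of_real (1 - (norm z)\<^sup>2)) (at 0)"
    using DERIV_chain2[of f "deriv f z" B 0] df dB B0 by simp
  then have "(g has_field_derivative (1 / of_real (1 - (norm a)\<^sup>2)) * (deriv f z * of_real (1 - (norm z)\<^sup>2))) (at 0)"
    unfolding g_def by (intro DERIV_chain2[of A]) (use dA in \<open>simp only: B0 a_def\<close>)
  then have "deriv g 0 = (1 / of_real (1 - (norm a)\<^sup>2)) * (deriv f z * of_real (1 - (norm z)\<^sup>2))"
    by (rule DERIV_imp_deriv)
  then have "norm (deriv g 0) = norm (deriv f z) * (1 - (norm z)\<^sup>2) / (1 - (norm a)\<^sup>2)"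
    using apos zpos by (simp only: norm_mult norm_divide norm_of_real) (simp add: norm_mult)
  with \<open>norm (deriv g 0) \<le> 1\<close> apos show ?thesis by (simp add: a_def divide_simps)
qed

lemma universal_covering_deriv_le:
  assumes p: "holomorphic_universal_covering p D" and q: "holomorphic_universal_covering q D"
    and u: "u \<in> ball 0 1" and v: "v \<in> ball 0 1" and eq: "p u = q v"
  shows "(1 - (norm u)\<^sup>2) * norm (deriv p u) \<le> (1 - (norm v)\<^sup>2) * norm (deriv q v)"
proof -
  have hp: "p holomorphic_on ball 0 1" and hq: "q holomorphic_on ball 0 1"
    and cp: "covering_space (ball 0 1) p D" and cq: "covering_space (ball 0 1) q D"
    using p q by (auto simp: holomorphic_universal_covering_def)
  have pim: "p \<in> ball 0 1 \<rightarrow> D" using covering_space_imp_surjective[OF cp] by auto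
  obtain g where g: "continuous_on (ball 0 1) g" "g \<in> ball 0 1 \<rightarrow> ball 0 1" "g u = v"
      "\<And>y. y \<in> ball 0 1 \<Longrightarrow> q (g y) = p y"
    using covering_space_lift_strong[OF cq v u convex_imp_simply_connected
        convex_imp_locally_path_connected holomorphic_on_imp_continuous_on[OF hp] pim eq]
    by (metis convex_ball)
  have holg: "g holomorphic_on ball 0 1"
    by (rule covering_space_lift_is_holomorphic[OF cq open_ball hq hp pim g(2,1,4)])
  have "((\<lambda>y. q (g y)) has_field_derivative deriv q v * deriv g u) (at u)"
    using DERIV_chain2[of q "deriv q v" g u] holomorphic_derivI[OF hq open_ball v]
      holomorphic_derivI[OF holg open_ball u] g(3) by simp
  then have "(p has_field_derivative deriv q v * deriv g u) (at u)"
    by (rule has_field_derivative_transform_within_open[OF _ open_ball u]) (use g(4) in auto)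
  then have "deriv p u = deriv q v * deriv g u" by (rule DERIV_imp_deriv)
  then have "(1 - (norm u)\<^sup>2) * norm (deriv p u) =
      norm (deriv q v) * (norm (deriv g u) * (1 - (norm u)\<^sup>2))"
    by (simp add: norm_mult)
  also have "\<dots> \<le> norm (deriv q v) * (1 - (norm v)\<^sup>2)"
    using Schwarz_Pick_deriv[OF holg g(2) u] g(3) by (intro mult_left_mono) auto
  finally show ?thesis by (simp add: mult.commute)
qed

lemma universal_covering_deriv_nonzero:
  assumes p: "holomorphic_universal_covering p D" and z: "z \<in> ball 0 1"
  shows "deriv p z \<noteq> 0"
proof -
  obtain T U q where T: "z \<in> T" "openin (top_of_set (ball 0 1)) T" "homeomorphism T U p q"
    using covering_space_local_homeomorphism p z
    unfolding holomorphic_universal_covering_def by metis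
  have "open T" "T \<subseteq> ball 0 1"
    using T(2) open_ball openin_open_trans openin_imp_subset by blast+
  moreover have "inj_on p T" using T(3) by (metis homeomorphism_def inj_on_inverseI)
  ultimately show ?thesis
    using holomorphic_injective_imp_regular[of p T z] T(1) p holomorphic_on_subset
    unfolding holomorphic_universal_covering_def by blast
qed

lemma hyperbolic_density_covering:
  assumes p: "holomorphic_universal_covering p D" and z: "z \<in> ball 0 1"
  shows "hyperbolic_density D (p z) * ennreal (norm (deriv p z)) = ennreal (1 / (1 - (norm z)\<^sup>2))"
proof -
  let ?S = "{(q, u). holomorphic_universal_covering q D \<and> u \<in> ball 0 1 \<and> q u = p z}"
  let ?F = "\<lambda>(q, u). ennreal (1 / ((1 - (norm u)\<^sup>2) * norm (deriv q u)))"
  have "?F x = ?F (p, z)" if "x \<in> ?S" for x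
  proof -
    obtain q u where x: "x = (q, u)" by (cases x)
    then have "(1 - (norm u)\<^sup>2) * norm (deriv q u) = (1 - (norm z)\<^sup>2) * norm (deriv p z)"
      using that universal_covering_deriv_le[OF p _ z, of q u] universal_covering_deriv_le[OF _ p _ z, of q u]
      by auto
    then show ?thesis by (simp add: x)
  qed
  moreover have "(p, z) \<in> ?S" using p z by simp
  ultimately have "hyperbolic_density D (p z) = ?F (p, z)"
    unfolding hyperbolic_density_def by (intro INF_eq_const) blast+
  moreover have "1 - (norm z)\<^sup>2 > 0" using z by (simp add: abs_square_less_1)
  ultimately show ?thesis
    using universal_covering_deriv_nonzero[OF p z]
    by (simp add: ennreal_mult[symmetric])
qed

end

theory Submission
  imports Defs "HOL-Real_Asymp.Real_Asymp"
begin

text \<open>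
  Fix \<open>a \<notin> \<Omega>\<close>. Since \<open>\<Omega>\<close> is invariant under \<open>w \<mapsto> w + 1\<close>, it omits all the points
  \<open>a - n\<close>. Seen from far away these points fill the ray from \<open>a\<close> to the left, and the complement
  of a ray has density at least \<open>1 / (4 \<bar>w - a\<bar>)\<close>; this is where the constant \<open>1/4\<close> comes from. So for
  each \<open>\<epsilon> > 0\<close> the density of \<open>\<Omega>\<close> should be at least \<open>1 / ((4 + \<epsilon>) \<bar>w - a\<bar>)\<close> once \<open>\<bar>w - a\<bar>\<close> is
  large, and integrating this along a path from \<open>z\<close> to \<open>z + n\<close>, after it has left a fixed disc about \<open>a\<close> for
  the last time, gives \<open>(ln n - O(1)) / (4 + \<epsilon>)\<close>.

  The density estimate is a statement about holomorphic maps \<open>f\<close> of the disc that omit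
  \<open>0, -1, -2, \<dots>\<close>: if \<open>\<bar>f 0\<bar>\<close> is large, then \<open>\<bar>f' 0\<bar> \<le> (4 + \<epsilon>) \<bar>f 0\<bar>\<close>
  (lemma \<open>omit_nat_deriv_le\<close>). It follows by compactness. Rescaled counterexamples
  \<open>f\<^sub>k / \<bar>f\<^sub>k 0\<bar>\<close> with \<open>\<bar>f\<^sub>k 0\<bar> \<rightarrow> \<infinity>\<close> omit \<open>0\<close> and a point of modulus between \<open>1\<close> and \<open>2\<close>, so
  by the theorems of Schottky and Montel a subsequence converges locally uniformly. The rescaled maps omit finer
  and finer subdivisions of the negative axis, hence by Hurwitz's theorem the limit \<open>g\<close> omits the
  whole closed negative half-line (lemma \<open>omit_scaled_nat_limit\<close>). The Schwarz lemma, applied to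
  the square root of \<open>g\<close>, then yields \<open>\<bar>g' 0\<bar> \<le> 4 \<bar>g 0\<bar> = 4\<close>, while the counterexamples force
  \<open>\<bar>g' 0\<bar> \<ge> 4 + \<epsilon>\<close>.
\<close>

section \<open>Maps into a slit plane and maps omitting two values\<close>

text \<open>
  The square root maps the slit plane onto the right half-plane, and \<open>w \<mapsto> (w - s) / (w + cnj s)\<close> maps
  the half-plane onto the disc, sending \<open>s\<close> to \<open>0\<close>; the Schwarz lemma applies to the composition.
  Equality holds for the Koebe-type map \<open>((1 + z) / (1 - z))\<^sup>2\<close>.
\<close>
lemma holomorphic_slit_plane_deriv_le:
  assumes holg: "g holomorphic_on ball 0 1"
    and slit: "\<And>z. z \<in> ball 0 1 \<Longrightarrow> g z \<notin> \<real>\<^sub>\<le>\<^sub>0"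
  shows "norm (deriv g 0) \<le> 4 * norm (g 0)"
proof -
  define h where "h = (\<lambda>z. csqrt (g z))"
  define s where "s = h 0"
  define \<phi> where "\<phi> = (\<lambda>z. (h z - s) / (h z + cnj s))"
  have holh: "h holomorphic_on ball 0 1"
    unfolding h_def by (intro holomorphic_intros holg slit)
  have Reh: "Re (h z) > 0" if "z \<in> ball 0 1" for z
  proof -
    have "h z \<noteq> 0" "h z \<notin> \<real>\<^sub>\<le>\<^sub>0" using slit[OF that] by (auto simp: h_def)
    moreover have "0 < Re (csqrt (g z)) \<or> Re (csqrt (g z)) = 0 \<and> 0 \<le> Im (csqrt (g z))"
      by (rule csqrt_principal)
    moreover have "Re (h z) \<noteq> 0"
    proof
      assume "Re (h z) = 0"
      then have "(h z)\<^sup>2 = of_real (- (Im (h z))\<^sup>2)"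
        by (simp add: complex_eq_iff power2_eq_square)
      moreover have "(h z)\<^sup>2 = g z" by (simp add: h_def del: csqrt.sel)
      ultimately have "g z = of_real (- (Im (h z))\<^sup>2)" by (rule trans[OF sym, rotated])
      then have "g z \<in> \<real>\<^sub>\<le>\<^sub>0" by (simp only: nonpos_Reals_of_real_iff) simp
      then show False using slit[OF that] by blast
    qed
    ultimately show ?thesis by (auto simp: h_def)
  qed
  have s: "Re s > 0" using Reh[of 0] by (simp add: s_def)
  have nz: "h z + cnj s \<noteq> 0" if "z \<in> ball 0 1" for z
    using Reh[OF that] s by (auto simp: complex_eq_iff)
  have hol\<phi>: "\<phi> holomorphic_on ball 0 1"
    unfolding \<phi>_def by (intro holomorphic_intros holh nz)
  have "norm (\<phi> z) < 1" if "norm z < 1" for z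
  proof -
    have z: "z \<in> ball 0 1" using that by simp
    \<comment> \<open>A point of the half-plane is closer to \<open>s\<close> than to the mirror image \<open>- cnj s\<close>.\<close>
    have "(norm (h z + cnj s))\<^sup>2 - (norm (h z - s))\<^sup>2 = 4 * (Re (h z) * Re s)"
      unfolding cmod_power2 by (simp add: power2_eq_square algebra_simps)
    also have "\<dots> > 0" using Reh[OF z] s by simp
    finally have "norm (h z - s) < norm (h z + cnj s)"
      by (simp add: power2_less_imp_less)
    then show ?thesis using nz[OF z] by (simp add: \<phi>_def norm_divide)
  qed
  moreover have "\<phi> 0 = 0" by (simp add: \<phi>_def s_def)
  ultimately have le1: "norm (deriv \<phi> 0) \<le> 1"
    using Schwarz_Lemma(2)[OF hol\<phi>, of 0] by simp
  have dh: "(h has_field_derivative deriv g 0 / (2 * s)) (at 0)"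
    unfolding s_def h_def
    by (intro has_field_derivative_csqrt' slit holomorphic_derivI[OF holg]) auto
  have "s + cnj s \<noteq> 0" using nz[of 0] by (simp add: s_def)
  then have "(\<phi> has_field_derivative deriv g 0 / (2 * s) / (s + cnj s)) (at 0)"
    unfolding \<phi>_def
    by (auto intro!: derivative_eq_intros dh simp: s_def[symmetric] divide_simps)
  then have "deriv \<phi> 0 = deriv g 0 / (2 * s) / (s + cnj s)" by (rule DERIV_imp_deriv)
  moreover have "s + cnj s = of_real (2 * Re s)" by (simp add: complex_eq_iff)
  ultimately have "norm (deriv g 0) / (2 * norm s * (2 * Re s)) \<le> 1"
    using le1 s by (simp add: norm_divide norm_mult del: of_real_mult)
  moreover have "norm s > 0" using s by auto
  ultimately have "norm (deriv g 0) \<le> 4 * (norm s * Re s)"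
    using s by (simp add: divide_simps mult_ac)
  also have "\<dots> \<le> 4 * (norm s * norm s)"
    using complex_Re_le_cmod[of s] by (intro mult_left_mono) auto
  also have "norm s * norm s = norm (g 0)"
    by (metis norm_mult power2_eq_square power2_csqrt s_def h_def)
  finally show ?thesis .
qed

text \<open>
  Schottky's theorem normalises the omitted values to \<open>0\<close> and \<open>1\<close> and asks for holomorphy on the closed
  disc. Dividing by \<open>c\<close> achieves the first; for the second, \<open>f\<close> is restricted to the disc of radius
  \<open>(1 + t) / 2\<close>, halfway between \<open>t\<close> and \<open>1\<close>.
\<close>
lemma Schottky_omitting_two_values:
  assumes holf: "f holomorphic_on ball 0 1" and c: "c \<noteq> 0"
    and f0: "norm (f 0) \<le> r * norm c"
    and omit: "\<And>z. z \<in> ball 0 1 \<Longrightarrow> f z \<noteq> 0 \<and> f z \<noteq> c"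
    and t: "0 < t" "t < 1" "norm z \<le> t"
  shows "norm (f z) \<le> norm c * exp (pi * exp (pi * (2 + 2 * r + 24 * t / (1 - t))))"
proof -
  define s where "s = (1 + t) / 2"
  have s: "0 < s" "s < 1" "t < s" using t by (auto simp: s_def)
  define F where "F = (\<lambda>z. f (of_real s * z) / c)"
  have mem: "of_real s * u \<in> ball 0 1" if "u \<in> cball 0 1" for u :: complex
  proof -
    have "s * norm u \<le> s * 1" using that s by (intro mult_left_mono) auto
    then have "s * norm u < 1" using s by linarith
    then show ?thesis using s by (simp add: norm_mult)
  qed
  have "norm (F (z / of_real s)) \<le> exp (pi * exp (pi * (2 + 2 * r + 12 * (t / s) / (1 - t / s))))"
  proof (rule Schottky[where f = F])
    have "(f \<circ> (\<lambda>z. of_real s * z)) holomorphic_on cball 0 1"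
      using mem by (intro holomorphic_on_compose_gen[OF _ holf] holomorphic_intros) blast
    then show "F holomorphic_on cball 0 1"
      unfolding F_def o_def using c by (intro holomorphic_intros) auto
    show "norm (F 0) \<le> r" using f0 c by (simp add: F_def norm_divide divide_simps)
    show "\<not> (F u = 0 \<or> F u = 1)" if "u \<in> cball 0 1" for u
      using omit[OF mem[OF that]] c by (auto simp: F_def)
    show "0 < t / s" "t / s < 1" "norm (z / of_real s) \<le> t / s"
      using s t by (auto simp: norm_divide divide_right_mono)
  qed
  moreover have "12 * (t / s) / (1 - t / s) = 24 * t / (1 - t)"
  proof -
    have "t / s = 2 * t / (1 + t)" by (simp add: s_def)
    moreover have "1 - 2 * t / (1 + t) = (1 - t) / (1 + t)" using t by (simp add: field_simps)
    ultimately show ?thesis using t by simp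
  qed
  moreover have "F (z / of_real s) = f z / c" using s by (simp add: F_def)
  ultimately have "norm (f z / c) \<le> exp (pi * exp (pi * (2 + 2 * r + 24 * t / (1 - t))))"
    by (simp only:)
  then show ?thesis using c by (simp add: norm_divide pos_divide_le_eq mult.commute)
qed

section \<open>Maps omitting the nonpositive integers\<close>

lemma floor_ratio_tendsto:
  fixes R :: "nat \<Rightarrow> real"
  assumes R: "filterlim R at_top sequentially" and x: "x \<ge> 0"
  shows "(\<lambda>k. real (nat \<lfloor>x * R k\<rfloor>) / R k) \<longlonglongrightarrow> x"
proof -
  have inv: "(\<lambda>k. 1 / R k) \<longlonglongrightarrow> 0"
    using tendsto_inverse_0_at_top[OF R] by (simp add: inverse_eq_divide)
  have ev: "\<forall>\<^sub>F k in sequentially. R k > 0"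
    using R by (simp add: filterlim_at_top_dense)
  have bd: "x - 1 / R k \<le> real (nat \<lfloor>x * R k\<rfloor>) / R k \<and> real (nat \<lfloor>x * R k\<rfloor>) / R k \<le> x"
    if "R k > 0" for k
  proof -
    have "x * R k \<ge> 0" using x that by simp
    then have "x * R k - 1 \<le> real (nat \<lfloor>x * R k\<rfloor>)" "real (nat \<lfloor>x * R k\<rfloor>) \<le> x * R k"
      by linarith+
    then have "(x * R k - 1) / R k \<le> real (nat \<lfloor>x * R k\<rfloor>) / R k"
        "real (nat \<lfloor>x * R k\<rfloor>) / R k \<le> x * R k / R k"
      by - (rule divide_right_mono, assumption, rule less_imp_le[OF that])+
    moreover have "(x * R k - 1) / R k = x - 1 / R k" "x * R k / R k = x"
      using that by (simp_all add: diff_divide_distrib)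
    ultimately show ?thesis by (simp only: simp_thms)
  qed
  show ?thesis
  proof (rule tendsto_sandwich)
    show "(\<lambda>k. x - 1 / R k) \<longlonglongrightarrow> x" using tendsto_diff[OF tendsto_const inv, of x] by simp
    show "\<forall>\<^sub>F k in sequentially. x - 1 / R k \<le> real (nat \<lfloor>x * R k\<rfloor>) / R k"
      using ev by eventually_elim (use bd in blast)
    show "\<forall>\<^sub>F k in sequentially. real (nat \<lfloor>x * R k\<rfloor>) / R k \<le> x"
      using ev by eventually_elim (use bd in blast)
  qed simp
qed

text \<open>
  If the limit took a value \<open>- x\<close> with \<open>x \<ge> 0\<close>, then Hurwitz's theorem would be contradicted by the
  functions \<open>G k\<close> shifted by the omitted grid points \<open>\<lfloor>x R\<^sub>k\<rfloor> / R\<^sub>k\<close>, which tend to \<open>x\<close>.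
\<close>
lemma omit_scaled_nat_limit:
  fixes R :: "nat \<Rightarrow> real"
  assumes R: "filterlim R at_top sequentially" "\<And>k. R k > 0"
    and holG: "\<And>k. G k holomorphic_on ball 0 1"
    and omit: "\<And>k z j. z \<in> ball 0 1 \<Longrightarrow> G k z \<noteq> - of_real (real j / R k)"
    and holg: "g holomorphic_on ball 0 1"
    and lim: "\<And>K. compact K \<Longrightarrow> K \<subseteq> ball 0 1 \<Longrightarrow> uniform_limit K G g sequentially"
    and nonconst: "\<not> g constant_on ball 0 1"
    and z: "z \<in> ball 0 1"
  shows "g z \<notin> \<real>\<^sub>\<le>\<^sub>0"
proof
  assume "g z \<in> \<real>\<^sub>\<le>\<^sub>0"
  then obtain x where x: "x \<ge> 0" "g z = - of_real x"
    by (metis nonpos_Reals_cases of_real_minus neg_0_le_iff_le minus_minus)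
  define y where "y = (\<lambda>k. real (nat \<lfloor>x * R k\<rfloor>) / R k)"
  have y: "y \<longlonglongrightarrow> x" unfolding y_def using R(1) x(1) by (rule floor_ratio_tendsto)
  have "g z + of_real x \<noteq> 0"
  proof (rule Hurwitz_no_zeros[where S = "ball 0 1" and \<F> = "\<lambda>k u. G k u + of_real (y k)"
        and g = "\<lambda>u. g u + of_real x"])
    show "\<not> (\<lambda>u. g u + of_real x) constant_on ball 0 1"
      using nonconst unfolding constant_on_def by (metis add_diff_cancel_right')
    show "G k u + of_real (y k) \<noteq> 0" if "u \<in> ball 0 1" for k u
      using omit[OF that] unfolding y_def by (simp add: add_eq_0_iff2)
    show "uniform_limit K (\<lambda>k u. G k u + of_real (y k)) (\<lambda>u. g u + of_real x) sequentially"
      if "compact K" "K \<subseteq> ball 0 1" for K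
    proof (rule uniform_limit_add[OF lim[OF that]])
      have "(\<lambda>k. of_real (y k) :: complex) \<longlonglongrightarrow> of_real x" using y by (rule tendsto_of_real)
      then show "uniform_limit K (\<lambda>k u. of_real (y k) :: complex) (\<lambda>u. of_real x) sequentially"
        by (auto intro!: uniform_limitI dest: tendstoD elim: eventually_mono)
    qed
  qed (use z in \<open>auto intro!: holomorphic_intros holG holg\<close>)
  then show False using x by simp
qed

text \<open>
  The threshold \<open>R\<close> comes from a compactness argument and is not explicit; what matters is that it depends
  on \<open>\<epsilon>\<close> only, so that the same \<open>R\<close> serves all recentred coverings of a domain.
\<close>
lemma omit_nat_deriv_le:
  fixes \<epsilon> :: real
  assumes \<epsilon>: "\<epsilon> > 0"
  obtains R where "R \<ge> 1"
    and "\<And>f. \<lbrakk>f holomorphic_on ball 0 1; \<And>z n. z \<in> ball 0 1 \<Longrightarrow> f z \<noteq> - of_nat n; norm (f 0) \<ge> R\<rbrakk>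
           \<Longrightarrow> norm (deriv f 0) \<le> (4 + \<epsilon>) * norm (f 0)"
proof -
  let ?P = "\<lambda>f. f holomorphic_on ball 0 1 \<and> (\<forall>z\<in>ball 0 1. \<forall>n. f z \<noteq> - of_nat n)"
  have "\<exists>R\<ge>1. \<forall>f. ?P f \<and> norm (f 0) \<ge> R \<longrightarrow> norm (deriv f 0) \<le> (4 + \<epsilon>) * norm (f 0)"
  proof (rule ccontr)
    assume "\<not> ?thesis"
    then have "\<exists>f. ?P f \<and> norm (f 0) \<ge> real k + 1 \<and> norm (deriv f 0) > (4 + \<epsilon>) * norm (f 0)" for k
      by (metis not_le of_nat_0_le_iff le_add_same_cancel2)
    then obtain f where hol: "\<And>k. f k holomorphic_on ball 0 1"
      and omit: "\<And>k z n. z \<in> ball 0 1 \<Longrightarrow> f k z \<noteq> - of_nat n"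
      and big: "\<And>k. norm (f k 0) \<ge> real k + 1"
      and der: "\<And>k. norm (deriv (f k) 0) > (4 + \<epsilon>) * norm (f k 0)"
      by metis
    define R where "R = (\<lambda>k. norm (f k 0))"
    have R1: "R k \<ge> 1" for k using big[of k] by (simp add: R_def)
    then have Rpos: "R k > 0" for k by (rule less_le_trans[OF zero_less_one])
    have Rlim: "filterlim R at_top sequentially"
    proof (rule filterlim_at_top_mono[OF filterlim_real_sequentially])
      show "\<forall>\<^sub>F k in sequentially. real k \<le> R k"
      proof (intro always_eventually allI)
        show "real k \<le> R k" for k using big[of k] by (simp add: R_def)
      qed
    qed
    define G where "G = (\<lambda>k z. f k z / of_real (R k))"
    have holG: "G k holomorphic_on ball 0 1" for k
      unfolding G_def using Rpos[of k] by (intro holomorphic_intros hol) auto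
    have G0: "norm (G k 0) = 1" for k
      using Rpos[of k] by (simp add: G_def norm_divide R_def)
    have omitG: "G k z \<noteq> - of_real (real j / R k)" if "z \<in> ball 0 1" for k z j
      using omit[OF that, of k j] Rpos[of k] by (simp add: G_def divide_simps)
    \<comment> \<open>The second omitted value varies with the function, but in an annulus, so Schottky's bound is
      uniform over the family.\<close>
    define \<H> where "\<H> = {h. h holomorphic_on ball 0 1 \<and> norm (h 0) = 1 \<and>
      (\<exists>c. 1 \<le> norm c \<and> norm c \<le> 2 \<and> (\<forall>z\<in>ball 0 1. h z \<noteq> 0 \<and> h z \<noteq> c))}"
    have "range G \<subseteq> \<H>"
    proof clarify
      fix k
      \<comment> \<open>As \<open>R k \<ge> 1\<close>, the grid of mesh \<open>1 / R k\<close> has a point in \<open>[-2, -1]\<close>.\<close>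
      define j where "j = nat \<lceil>R k\<rceil>"
      define c :: complex where "c = - of_real (real j / R k)"
      have "R k \<le> real j" "real j \<le> R k + 1" using Rpos[of k] unfolding j_def by linarith+
      then have "1 \<le> norm c" "norm c \<le> 2"
        using Rpos[of k] R1[of k] by (auto simp: c_def norm_divide divide_simps)
      moreover have "G k z \<noteq> 0 \<and> G k z \<noteq> c" if "z \<in> ball 0 1" for z
        using omitG[OF that, of k 0] omitG[OF that, of k j] by (simp add: c_def)
      ultimately show "G k \<in> \<H>" using holG G0 unfolding \<H>_def by blast
    qed
    moreover have "\<exists>B. \<forall>h\<in>\<H>. \<forall>z\<in>K. norm (h z) \<le> B" if K: "compact K" "K \<subseteq> ball 0 1" for K
    proof -
      obtain t where t: "0 < t" "t < 1" "K \<subseteq> cball 0 t"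
      proof (cases "K = {}")
        case False
        then obtain u where u: "u \<in> K" "\<And>z. z \<in> K \<Longrightarrow> norm z \<le> norm u"
          using continuous_attains_sup[OF K(1) _ continuous_on_norm_id] by auto
        have "norm u < 1" using u(1) K(2) by auto
        show ?thesis
        proof (rule that)
          show "0 < (1 + norm u) / 2" by (simp add: add_pos_nonneg)
          show "(1 + norm u) / 2 < 1" using \<open>norm u < 1\<close> by simp
          show "K \<subseteq> cball 0 ((1 + norm u) / 2)"
          proof
            fix z assume "z \<in> K"
            with u(2) \<open>norm u < 1\<close> have "norm z \<le> (1 + norm u) / 2" by fastforce
            then show "z \<in> cball 0 ((1 + norm u) / 2)" by simp
          qed
        qed
      qed (use that[of "1/2"] in auto)
      define B where "B = exp (pi * exp (pi * (2 + 2 * 1 + 24 * t / (1 - t))))"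
      have "norm (h z) \<le> 2 * B" if h: "h \<in> \<H>" and z: "z \<in> K" for h z
      proof -
        obtain c where c: "1 \<le> norm c" "norm c \<le> 2"
          and o: "\<And>z. z \<in> ball 0 1 \<Longrightarrow> h z \<noteq> 0 \<and> h z \<noteq> c"
          and hh: "h holomorphic_on ball 0 1" "norm (h 0) = 1"
          using h unfolding \<H>_def by blast
        have "norm (h z) \<le> norm c * B"
          unfolding B_def using c hh t z
          by (intro Schottky_omitting_two_values[OF _ _ _ o]) auto
        also have "\<dots> \<le> 2 * B" using c by (intro mult_right_mono) (auto simp: B_def)
        finally show ?thesis .
      qed
      then show ?thesis by blast
    qed
    moreover have "\<And>h. h \<in> \<H> \<Longrightarrow> h holomorphic_on ball 0 1" by (simp add: \<H>_def)
    ultimately obtain g r where holg: "g holomorphic_on ball 0 1" and r: "strict_mono (r :: nat \<Rightarrow> nat)"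
      and pw: "\<And>x. x \<in> ball 0 1 \<Longrightarrow> (\<lambda>n. G (r n) x) \<longlonglongrightarrow> g x"
      and ul: "\<And>K. \<lbrakk>compact K; K \<subseteq> ball 0 1\<rbrakk> \<Longrightarrow> uniform_limit K (G \<circ> r) g sequentially"
      using Montel[OF open_ball, of \<H> 0 1 G] by metis
    have g0: "norm (g 0) = 1"
      using tendsto_norm[OF pw[of 0]] by (simp add: G0 LIMSEQ_const_iff)
    have "(\<lambda>n. (deriv ^^ 1) ((G \<circ> r) n) 0) \<longlonglongrightarrow> (deriv ^^ 1) g 0"
    proof (rule higher_deriv_complex_uniform_limit)
      show "uniform_limit (ball 0 (1/2)) (G \<circ> r) g sequentially"
        by (rule uniform_limit_on_subset[OF ul[of "cball 0 (1/2)"]]) auto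
      show "\<forall>\<^sub>F n in sequentially. (G \<circ> r) n holomorphic_on ball 0 (1/2)"
        by (intro always_eventually allI, unfold o_def, rule holomorphic_on_subset[OF holG]) auto
    qed auto
    then have "(\<lambda>n. norm (deriv (G (r n)) 0)) \<longlonglongrightarrow> norm (deriv g 0)"
      by (simp add: tendsto_norm)
    moreover have "norm (deriv (G k) 0) \<ge> 4 + \<epsilon>" for k
    proof -
      have "(f k has_field_derivative deriv (f k) 0) (at 0)"
        by (rule holomorphic_derivI[OF hol]) auto
      then have "(G k has_field_derivative deriv (f k) 0 / of_real (R k)) (at 0)"
        unfolding G_def by (rule DERIV_cdivide)
      then have "deriv (G k) 0 = deriv (f k) 0 / of_real (R k)" by (rule DERIV_imp_deriv)
      then show ?thesis
        using der[of k] Rpos[of k] by (simp add: norm_divide R_def pos_le_divide_eq)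
    qed
    ultimately have g': "norm (deriv g 0) \<ge> 4 + \<epsilon>"
      by (intro LIMSEQ_le_const) auto
    have "\<not> g constant_on ball 0 1"
    proof
      assume "g constant_on ball 0 1"
      then obtain c where c: "\<And>z. z \<in> ball 0 1 \<Longrightarrow> g z = c" by (auto simp: constant_on_def)
      have "(g has_field_derivative 0) (at 0)"
        by (rule has_field_derivative_transform_within_open[of "\<lambda>_. c" _ _ "ball 0 1"]) (auto simp: c)
      then show False using g' \<epsilon> by (simp add: DERIV_imp_deriv)
    qed
    then have "g z \<notin> \<real>\<^sub>\<le>\<^sub>0" if "z \<in> ball 0 1" for z
      by (intro omit_scaled_nat_limit[where R = "R \<circ> r" and G = "G \<circ> r"] ul holg)
        (use that Rpos holG omitG r in \<open>auto intro!: filterlim_compose[OF Rlim filterlim_subseq] simp: o_def\<close>)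
    then have "norm (deriv g 0) \<le> 4"
      using holomorphic_slit_plane_deriv_le[OF holg] g0 by auto
    then show False using g' \<epsilon> by linarith
  qed
  then show ?thesis using that by blast
qed

section \<open>A lower bound for the hyperbolic density\<close>

text \<open>Precomposition with a disc automorphism that sends \<open>0\<close> to \<open>u\<close>.\<close>
lemma holomorphic_disc_recentre:
  assumes p: "p holomorphic_on ball 0 1" and u: "u \<in> ball 0 1"
  obtains f where "f holomorphic_on ball 0 1" "f 0 = p u" "f ` ball 0 1 \<subseteq> p ` ball 0 1"
    "norm (deriv f 0) = (1 - (norm u)\<^sup>2) * norm (deriv p u)"
proof -
  define B where "B = Moebius_function 0 (- u)"
  have u1: "norm u < 1" using u by simp
  have Bim: "B ` ball 0 1 \<subseteq> ball 0 1"
    using Moebius_function_norm_lt_1[of "- u" _ 0] u1 by (auto simp: B_def)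
  have holB: "B holomorphic_on ball 0 1"
    using u1 by (simp add: B_def Moebius_function_holomorphic)
  have B0: "B 0 = u" by (simp add: B_def Moebius_function_of_zero)
  have dB: "(B has_field_derivative of_real (1 - (norm u)\<^sup>2)) (at 0)"
  proof -
    have "(B has_field_derivative (1 - u * cnj u)) (at 0)"
      unfolding B_def Moebius_function_def by (auto intro!: derivative_eq_intros)
    then show ?thesis by (simp only: of_real_diff complex_norm_square of_real_1)
  qed
  show ?thesis
  proof (rule that[of "p \<circ> B"])
    show "p \<circ> B holomorphic_on ball 0 1"
      by (rule holomorphic_on_compose_gen[OF holB p]) (use Bim in auto)
    show "(p \<circ> B) 0 = p u" by (simp add: B0)
    show "(p \<circ> B) ` ball 0 1 \<subseteq> p ` ball 0 1" using Bim by auto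
    have "(p has_field_derivative deriv p u) (at (B 0))"
      unfolding B0 by (rule holomorphic_derivI[OF p open_ball u])
    then have "deriv (p \<circ> B) 0 = deriv p u * of_real (1 - (norm u)\<^sup>2)"
      using dB by (intro DERIV_imp_deriv DERIV_chain)
    moreover have "(norm u)\<^sup>2 \<le> 1" using u1 by (simp add: abs_square_le_1)
    ultimately show "norm (deriv (p \<circ> B) 0) = (1 - (norm u)\<^sup>2) * norm (deriv p u)"
      by (simp only: norm_mult norm_of_real) simp
  qed
qed

text \<open>
  The density is an infimum over coverings, so each covering only has to satisfy the derivative estimate
  at each preimage of \<open>w\<close>; if there are none, the density is infinite and the bound is trivial.
\<close>
lemma hyperbolic_density_ge:
  fixes \<epsilon> :: real
  assumes \<epsilon>: "\<epsilon> > 0"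
  obtains R where "R \<ge> 1"
    and "\<And>D a w. \<lbrakk>\<And>n. a - of_nat n \<notin> D; norm (w - a) \<ge> R\<rbrakk>
           \<Longrightarrow> ennreal (1 / (4 + \<epsilon>) / norm (w - a)) \<le> hyperbolic_density D w"
proof -
  obtain R where R: "R \<ge> 1"
    and est: "\<And>f. \<lbrakk>f holomorphic_on ball 0 1; \<And>z n. z \<in> ball 0 1 \<Longrightarrow> f z \<noteq> - of_nat n; norm (f 0) \<ge> R\<rbrakk>
           \<Longrightarrow> norm (deriv f 0) \<le> (4 + \<epsilon>) * norm (f 0)"
    using omit_nat_deriv_le[OF \<epsilon>] by metis
  have "ennreal (1 / (4 + \<epsilon>) / norm (w - a)) \<le> hyperbolic_density D w"
    if omit: "\<And>n. a - of_nat n \<notin> D" and w: "norm (w - a) \<ge> R" for D a w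
    unfolding hyperbolic_density_def
  proof (rule INF_greatest, clarify)
    fix p u assume p: "holomorphic_universal_covering p D" and u: "u \<in> ball 0 1" and pu: "w = p u"
    have holp: "p holomorphic_on ball 0 1" and pim: "p ` ball 0 1 = D"
      using p covering_space_imp_surjective unfolding holomorphic_universal_covering_def by blast+
    obtain f where f: "f holomorphic_on ball 0 1" "f 0 = p u" "f ` ball 0 1 \<subseteq> p ` ball 0 1"
      "norm (deriv f 0) = (1 - (norm u)\<^sup>2) * norm (deriv p u)"
      using holomorphic_disc_recentre[OF holp u] by blast
    have "(f has_field_derivative deriv f 0) (at 0)"
      by (rule holomorphic_derivI[OF f(1)]) auto
    then have df: "deriv (\<lambda>z. f z - a) 0 = deriv f 0"
      by (intro DERIV_imp_deriv) (auto intro!: derivative_eq_intros)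
    have "norm (deriv (\<lambda>z. f z - a) 0) \<le> (4 + \<epsilon>) * norm (f 0 - a)"
    proof (rule est)
      show "(\<lambda>z. f z - a) holomorphic_on ball 0 1" by (intro holomorphic_intros f)
      show "f z - a \<noteq> - of_nat n" if "z \<in> ball 0 1" for z n
      proof
        assume "f z - a = - of_nat n"
        then have "f z = a - of_nat n" by (simp add: algebra_simps)
        moreover have "f z \<in> D" using f(3) pim that by blast
        ultimately show False using omit by metis
      qed
      show "R \<le> norm (f 0 - a)" using w pu f(2) by simp
    qed
    then have le: "(1 - (norm u)\<^sup>2) * norm (deriv p u) \<le> (4 + \<epsilon>) * norm (p u - a)"
      unfolding df f(2,4) .
    have "1 - (norm u)\<^sup>2 > 0" using u by (simp add: abs_square_less_1)
    then have "0 < (1 - (norm u)\<^sup>2) * norm (deriv p u)"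
      using universal_covering_deriv_nonzero[OF p u] by simp
    then have "1 / ((4 + \<epsilon>) * norm (p u - a)) \<le> 1 / ((1 - (norm u)\<^sup>2) * norm (deriv p u))"
      by (intro frac_le[OF _ _ _ le]) simp_all
    then show "ennreal (1 / (4 + \<epsilon>) / norm (p u - a)) \<le> ennreal (1 / ((1 - (norm u)\<^sup>2) * norm (deriv p u)))"
      by (intro ennreal_leI) simp
  qed
  then show ?thesis using that R by blast
qed

section \<open>Weighted length of a path that leaves a large disc\<close>

text \<open>
  The radial part of \<open>\<gamma>'\<close> alone accounts for the growth of \<open>ln \<bar>\<gamma> - a\<bar>\<close>. The derivative of a valid
  path may be unbounded near the exceptional points, so the integral on the right may be infinite; when it
  is finite, it is a gauge integral and can be compared with the fundamental theorem of calculus.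
\<close>
lemma nn_integral_inverse_norm_ge_ln:
  fixes \<gamma> :: "real \<Rightarrow> 'a::euclidean_space" and c :: real
  assumes \<gamma>: "valid_path \<gamma>" and c: "c \<ge> 0" and s: "0 \<le> s" "s \<le> 1"
    and nz: "\<And>t. t \<in> {s..1} \<Longrightarrow> \<gamma> t \<noteq> a"
  shows "ennreal (c * (ln (norm (\<gamma> 1 - a)) - ln (norm (\<gamma> s - a))))
    \<le> (\<integral>\<^sup>+ t \<in> {s..1}. ennreal (c / norm (\<gamma> t - a) * norm (vector_derivative \<gamma> (at t))) \<partial>lborel)"
proof -
  define v where "v = (\<lambda>t. vector_derivative \<gamma> (at t))"
  define g where "g = (\<lambda>t. c / norm (\<gamma> t - a) * norm (v t))"
  \<comment> \<open>On \<open>{s..1}\<close> this is \<open>c * ln \<bar>\<gamma> - a\<bar>\<close>, written so that it is visibly differentiable.\<close>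
  define h where "h = (\<lambda>t. c * ln ((\<gamma> t - a) \<bullet> (\<gamma> t - a)) / 2)"
  define h' where "h' = (\<lambda>t. c * ((\<gamma> t - a) \<bullet> v t) / ((\<gamma> t - a) \<bullet> (\<gamma> t - a)))"
  obtain S where cont: "continuous_on {0..1} \<gamma>" and S: "finite S"
    and C1: "\<gamma> C1_differentiable_on ({0..1} - S)"
    using \<gamma> unfolding valid_path_def piecewise_C1_differentiable_on_def by blast
  define A where "A = {s..1} - S"
  have sub: "{s..1} \<subseteq> {0..1}" using s by auto
  have A01: "A \<subseteq> {0..1} - S" using s by (auto simp: A_def)
  have cont_s: "continuous_on {s..1} \<gamma>" using cont sub by (rule continuous_on_subset)
  have pos: "(\<gamma> t - a) \<bullet> (\<gamma> t - a) > 0" if "t \<in> {s..1}" for t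
    using nz[OF that] by simp
  have h: "h t = c * ln (norm (\<gamma> t - a))" if "t \<in> {s..1}" for t
    using nz[OF that] by (simp add: h_def norm_eq_sqrt_inner ln_sqrt)
  have int_h: "(h' has_integral (h 1 - h s)) {s..1}"
  proof (rule fundamental_theorem_of_calculus_interior_strong[OF S s(2)])
    show "continuous_on {s..1} h"
      unfolding h_def using nz by (intro continuous_intros cont_s) auto
    fix t assume t: "t \<in> {s<..<1} - S"
    then have "\<gamma> differentiable at t"
      using C1 s unfolding C1_differentiable_on_eq by auto
    then have "(\<gamma> has_vector_derivative v t) (at t)"
      by (simp add: v_def vector_derivative_works)
    then have d: "(\<gamma> has_derivative (\<lambda>u. u *\<^sub>R v t)) (at t)"
      by (simp add: has_vector_derivative_def)
    show "(h has_vector_derivative h' t) (at t)"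
      unfolding has_vector_derivative_def h_def h'_def
      using pos[of t] t
      by (auto intro!: derivative_eq_intros d simp: inner_commute fun_eq_iff field_simps)
  qed
  have h'_le: "h' t \<le> g t" if "t \<in> {s..1}" for t
  proof -
    have "(\<gamma> t - a) \<bullet> v t \<le> norm (\<gamma> t - a) * norm (v t)" by (rule norm_cauchy_schwarz)
    then have "c * ((\<gamma> t - a) \<bullet> v t) \<le> c * (norm (\<gamma> t - a) * norm (v t))"
      using c by (rule mult_left_mono)
    then show ?thesis using nz[OF that]
      by (simp add: h'_def g_def power2_norm_eq_inner[symmetric] power2_eq_square divide_simps mult_ac)
  qed
  have g_cont: "continuous_on A g"
  proof -
    have "continuous_on A v"
      using C1 A01 unfolding C1_differentiable_on_eq v_def by (blast intro: continuous_on_subset)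
    moreover have "continuous_on A \<gamma>"
      using cont_s by (rule continuous_on_subset) (auto simp: A_def)
    ultimately show ?thesis
      unfolding g_def using nz by (intro continuous_intros) (auto simp: A_def)
  qed
  have "A \<in> sets borel" unfolding A_def
    by (intro sets.Diff borel_closed finite_imp_closed[OF S]) auto
  then have meas: "(\<lambda>t. indicator A t *\<^sub>R g t) \<in> borel_measurable lborel"
    using borel_measurable_continuous_on_indicator[OF _ g_cont] by simp
  have eq: "(\<integral>\<^sup>+ t \<in> A. ennreal (g t) \<partial>lborel) = (\<integral>\<^sup>+ t. ennreal (indicator A t *\<^sub>R g t) \<partial>lborel)"
    by (intro nn_integral_cong) (auto simp: indicator_def)
  have g0: "g t \<ge> 0" for t using c by (simp add: g_def)
  have "ennreal (h 1 - h s) \<le> (\<integral>\<^sup>+ t \<in> A. ennreal (g t) \<partial>lborel)"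
  proof (cases "(\<integral>\<^sup>+ t \<in> A. ennreal (g t) \<partial>lborel) = \<infinity>")
    case False
    then have int: "set_integrable lborel A g"
      unfolding set_integrable_def using meas g0
      by (intro integrableI_nonneg) (auto simp: eq less_top)
    have negl: "negligible S" using S by (rule negligible_finite)
    have "(g has_integral (LINT t:A|lborel. g t)) A"
      using set_borel_integral_eq_integral[OF int] by (simp add: has_integral_iff)
    moreover have "(g has_integral I) A \<longleftrightarrow> (g has_integral I) {s..1}" for I
      by (rule has_integral_spike_set_eq; rule negligible_subset[OF negl]) (auto simp: A_def)
    ultimately have "(g has_integral (LINT t:A|lborel. g t)) {s..1}" by simp
    then have "h 1 - h s \<le> (LINT t:A|lborel. g t)"
      by (rule has_integral_le[OF int_h _ h'_le])
    moreover have "ennreal (LINT t:A|lborel. g t) = (\<integral>\<^sup>+ t \<in> A. ennreal (g t) \<partial>lborel)"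
      unfolding eq set_lebesgue_integral_def using int g0
      by (intro nn_integral_eq_integral[symmetric]) (auto simp: set_integrable_def)
    ultimately show ?thesis by (metis ennreal_leI)
  qed simp
  also have "\<dots> \<le> (\<integral>\<^sup>+ t \<in> {s..1}. ennreal (g t) \<partial>lborel)"
    by (intro nn_integral_mono) (auto simp: A_def indicator_def)
  finally show ?thesis using h[of 1] h[of s] s by (simp add: g_def v_def right_diff_distrib)
qed

text \<open>
  The last crossing of the level \<open>R\<close> works: a later dip below \<open>R\<close> would force a further crossing, because
  the path ends outside the disc.
\<close>
lemma last_exit_time:
  fixes \<gamma> :: "real \<Rightarrow> 'a::real_normed_vector"
  assumes cont: "continuous_on {0..1} \<gamma>" and R: "norm (\<gamma> 0 - a) \<le> R" "R \<le> norm (\<gamma> 1 - a)"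
  obtains s where "0 \<le> s" "s \<le> 1" "norm (\<gamma> s - a) = R" "\<And>t. t \<in> {s..1} \<Longrightarrow> R \<le> norm (\<gamma> t - a)"
proof -
  define d where "d = (\<lambda>t. norm (\<gamma> t - a))"
  have cd: "continuous_on {0..1} d" unfolding d_def by (intro continuous_intros cont)
  define S where "S = {t \<in> {0..1}. d t = R}"
  have "S \<noteq> {}"
    using IVT'[of d 0 R 1] R cd unfolding S_def d_def by auto
  moreover have "closed S"
    unfolding S_def using cd by (intro continuous_closed_preimage_constant) auto
  then have "compact S"
    unfolding compact_eq_bounded_closed
    by (auto simp: S_def intro: bounded_subset[OF bounded_closed_interval[of 0 1]])
  ultimately obtain s where s: "s \<in> S" "\<And>t. t \<in> S \<Longrightarrow> t \<le> s"
    using compact_attains_sup by metis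
  have "R \<le> d t" if t: "t \<in> {s..1}" for t
  proof (rule ccontr)
    assume less: "\<not> R \<le> d t"
    have "continuous_on {t..1} d"
      by (rule continuous_on_subset[OF cd]) (use s t in \<open>auto simp: S_def\<close>)
    then obtain x where "t \<le> x" "x \<le> 1" "d x = R"
      using IVT'[of d t R 1] less R t unfolding d_def by auto
    then have "x \<in> S" using s t by (auto simp: S_def)
    then have "t = s" using s(2)[of x] t \<open>t \<le> x\<close> by auto
    then show False using less s by (simp add: S_def)
  qed
  then show ?thesis using that s unfolding S_def d_def by auto
qed

text \<open>
  The path may return to the disc of radius \<open>R\<close>, where nothing is known about \<open>\<rho>\<close>; only the part after the
  last exit is used.
\<close>
lemma path_integral_ge_ln:
  fixes \<gamma> :: "real \<Rightarrow> 'a::euclidean_space" and c R :: real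
  assumes \<gamma>: "valid_path \<gamma>" and c: "c \<ge> 0" and R: "R > 0"
    and \<rho>: "\<And>w. w \<in> path_image \<gamma> \<Longrightarrow> norm (w - a) \<ge> R \<Longrightarrow> ennreal (c / norm (w - a)) \<le> \<rho> w"
    and start: "norm (pathstart \<gamma> - a) \<le> R" and finish: "R \<le> norm (pathfinish \<gamma> - a)"
  shows "ennreal (c * (ln (norm (pathfinish \<gamma> - a)) - ln R))
    \<le> (\<integral>\<^sup>+ t \<in> {0..1}. \<rho> (\<gamma> t) * ennreal (norm (vector_derivative \<gamma> (at t))) \<partial>lborel)"
proof -
  let ?v = "\<lambda>t. norm (vector_derivative \<gamma> (at t))"
  obtain s where s: "0 \<le> s" "s \<le> 1" "norm (\<gamma> s - a) = R"
      and ge: "\<And>t. t \<in> {s..1} \<Longrightarrow> R \<le> norm (\<gamma> t - a)"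
    using last_exit_time[of \<gamma> a R] valid_path_imp_path[OF \<gamma>] start finish
    unfolding path_def pathstart_def pathfinish_def by blast
  have "\<gamma> t \<noteq> a" if "t \<in> {s..1}" for t using ge[OF that] R by auto
  then have "ennreal (c * (ln (norm (\<gamma> 1 - a)) - ln R))
    \<le> (\<integral>\<^sup>+ t \<in> {s..1}. ennreal (c / norm (\<gamma> t - a) * ?v t) \<partial>lborel)"
    using nn_integral_inverse_norm_ge_ln[OF \<gamma> c s(1,2), of a] by (simp add: s(3))
  also have "\<dots> \<le> (\<integral>\<^sup>+ t \<in> {0..1}. \<rho> (\<gamma> t) * ennreal (?v t) \<partial>lborel)"
  proof (rule nn_integral_mono)
    fix t :: real
    show "ennreal (c / norm (\<gamma> t - a) * ?v t) * indicator {s..1} t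
      \<le> \<rho> (\<gamma> t) * ennreal (?v t) * indicator {0..1} t"
    proof (cases "t \<in> {s..1}")
      case True
      then have t: "t \<in> {0..1}" using s by auto
      have "ennreal (c / norm (\<gamma> t - a)) * ennreal (?v t) \<le> \<rho> (\<gamma> t) * ennreal (?v t)"
        using ge[OF True] t by (intro mult_right_mono \<rho>) (auto simp: path_image_def)
      then show ?thesis using True t c by (simp add: ennreal_mult del: times_divide_eq_left)
    qed simp
  qed
  finally show ?thesis by (simp add: pathfinish_def)
qed

section \<open>Growth of the hyperbolic distance along an orbit of the translation\<close>

theorem proposition1p3:
  fixes \<Omega> :: "complex set" and z :: complex
  assumes "open \<Omega>" and "connected \<Omega>" and "\<Omega> \<noteq> UNIV"
    and "(\<lambda>w. w + 1) ` \<Omega> \<subseteq> \<Omega>"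
    and "z \<in> \<Omega>"
  shows "liminf (\<lambda>n. hyperbolic_dist \<Omega> z (z + of_nat n) / ennreal (ln (real n))) \<ge> 1 / 4"
proof -
  obtain a where a: "a \<notin> \<Omega>" using assms(3) by blast
  have shift: "w + of_nat n \<in> \<Omega>" if "w \<in> \<Omega>" for w n
  proof (induction n)
    case (Suc n)
    then have "w + of_nat n + 1 \<in> \<Omega>" using assms(4) by blast
    then show ?case by (simp add: add_ac)
  qed (use that in simp)
  have omit: "a - of_nat n \<notin> \<Omega>" for n using shift[of "a - of_nat n" n] a by auto
  define b where "b = norm (z - a)"
  show ?thesis
    unfolding le_Liminf_iff
  proof (intro allI impI)
    fix y :: ennreal assume y: "y < 1 / 4"
    have quarter: "(1 / 4 :: ennreal) = ennreal (1 / 4)"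
      by (simp add: ennreal_divide_numeral[symmetric] del: ennreal_divide_numeral)
    obtain x where x: "x \<ge> 0" "y = ennreal x" "x < 1 / 4"
      using y unfolding quarter by (cases y) (auto simp: ennreal_less_iff)
    \<comment> \<open>The room between \<open>x\<close> and \<open>q\<close> absorbs the bounded error terms, the room between \<open>q\<close> and \<open>1/4\<close>
      the \<open>\<epsilon>\<close> of the density estimate.\<close>
    obtain q where q: "x < q" "q < 1 / 4" using dense x by blast
    define \<epsilon> where "\<epsilon> = 1 / q - 4"
    have \<epsilon>: "\<epsilon> > 0" "1 / (4 + \<epsilon>) = q" using q x by (auto simp: \<epsilon>_def field_simps)
    obtain R0 where R0: "R0 \<ge> 1" and dens: "\<And>w. norm (w - a) \<ge> R0 \<Longrightarrow>
        ennreal (q / norm (w - a)) \<le> hyperbolic_density \<Omega> w"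
      using hyperbolic_density_ge[OF \<epsilon>(1)] omit unfolding \<epsilon>(2) by metis
    \<comment> \<open>The disc of radius \<open>R\<close> has to contain the starting point \<open>z\<close>.\<close>
    define R where "R = max R0 b"
    have dist: "ennreal (q * (ln (norm (z + of_nat n - a)) - ln R)) \<le> hyperbolic_dist \<Omega> z (z + of_nat n)"
      if n: "real n \<ge> R + b" for n
      unfolding hyperbolic_dist_def
    proof (rule INF_greatest, clarify)
      fix \<gamma> assume \<gamma>: "valid_path \<gamma>" "pathfinish \<gamma> = pathstart \<gamma> + of_nat n" "z = pathstart \<gamma>"
      have "real n = norm ((pathstart \<gamma> + of_nat n - a) - (pathstart \<gamma> - a))" by simp
      also have "\<dots> \<le> norm (pathstart \<gamma> + of_nat n - a) + b"
        using \<gamma>(3) unfolding b_def by (metis norm_triangle_ineq4)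
      finally have "R \<le> norm (pathstart \<gamma> + of_nat n - a)" using n by linarith
      then show "ennreal (q * (ln (norm (pathstart \<gamma> + of_nat n - a)) - ln R))
        \<le> (\<integral>\<^sup>+ t \<in> {0..1}. hyperbolic_density \<Omega> (\<gamma> t) * ennreal (norm (vector_derivative \<gamma> (at t))) \<partial>lborel)"
        using path_integral_ge_ln[OF \<gamma>(1), of q R a "hyperbolic_density \<Omega>"] \<gamma> dens q x R0
        by (auto simp: R_def b_def)
    qed
    have "((\<lambda>n. q * (ln (real n - b) - ln R) / ln (real n)) \<longlongrightarrow> q) sequentially"
      by real_asymp
    then have "\<forall>\<^sub>F n in sequentially. x < q * (ln (real n - b) - ln R) / ln (real n)"
      using q(1) by (rule order_tendstoD)
    moreover have "\<forall>\<^sub>F n in sequentially. real n \<ge> R + b" by real_asymp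
    moreover have "\<forall>\<^sub>F n in sequentially. n \<ge> (2::nat)" by (rule eventually_ge_at_top)
    ultimately show "\<forall>\<^sub>F n in sequentially. y < hyperbolic_dist \<Omega> z (z + of_nat n) / ennreal (ln (real n))"
    proof eventually_elim
      case (elim n)
      have ln: "ln (real n) > 0" using elim(3) by simp
      have "real n = norm ((z + of_nat n - a) - (z - a))" by simp
      also have "\<dots> \<le> norm (z + of_nat n - a) + b" unfolding b_def by (rule norm_triangle_ineq4)
      finally have nb: "real n - b \<le> norm (z + of_nat n - a)" by simp
      have "R \<ge> 1" using R0 by (simp add: R_def)
      with elim(2) have "real n - b > 0" by linarith
      then have "ln (real n - b) \<le> ln (norm (z + of_nat n - a))"
        using nb by (intro ln_mono) auto
      then have "q * (ln (real n - b) - ln R) \<le> q * (ln (norm (z + of_nat n - a)) - ln R)"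
        using q x by (intro mult_left_mono) auto
      then have "ennreal (q * (ln (real n - b) - ln R)) \<le> hyperbolic_dist \<Omega> z (z + of_nat n)"
        using dist[OF elim(2)] by (meson ennreal_leI order_trans)
      have pos: "0 < q * (ln (real n - b) - ln R) / ln (real n)" using elim(1) x(1) by linarith
      have "y < ennreal (q * (ln (real n - b) - ln R) / ln (real n))"
        using elim(1) x by (simp add: ennreal_less_iff)
      also have "\<dots> = ennreal (q * (ln (real n - b) - ln R)) / ennreal (ln (real n))"
        using pos ln by (intro divide_ennreal[symmetric]) (auto simp: zero_less_divide_iff)
      also have "\<dots> \<le> hyperbolic_dist \<Omega> z (z + of_nat n) / ennreal (ln (real n))"
        by (rule divide_right_mono_ennreal) fact
      finally show ?case .
    qed
  qed
qed

end
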